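(* For every integer $n\geq 0$, (i) $b_{6,e}(n) = c(n)$ if $n$ is even, and $b_{6,e}(n)=d(n-2)$ if $n$ is odd; (ii) $b_{6,o}(n) = c(n)$ if $n$ is odd, and $b_{6,o}(n)=d(n-2)$ if $n$ is even.
   Context: A partition is called $6$-regular if none of its parts is divisible by $6$. $b_{6,e}(n)$ (respectively $b_{6,o}(n)$) denotes the number of $6$-regular partitions of $n$ into an even (respectively odd) number of parts, where parts are counted with multiplicity. $c(n)$ denotes the number of partitions of $n$ into parts which are not congruent to $0,\pm 2,\pm 20,\pm 22,24$ modulo $48$. $d(n)$ denotes the number of partitions of $n$ into parts which are not congruent to $0,\pm 4,\pm 10,\pm 14,24$ modulo $48$. The empty partition is the only partition of $0$ and has $0$ parts (so $c(0)=d(0)=1$), and $d(n)=0$ for $n<0$. *)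

theory Defs
  imports "HOL-Number_Theory.Cong" "HOL-Library.Multiset"
begin

definition partitions_of :: "nat \<Rightarrow> nat multiset set" where
  "partitions_of n = {p. 0 \<notin># p \<and> sum_mset p = n}"

(* The counts below are cardinalities of subsets of partitions_of n, so finiteness
   guarantees that they are genuine counts. *)
lemma finite_partitions_of: "finite (partitions_of n)"
proof (induction n rule: less_induct)
  case (less n)
  have "partitions_of n \<subseteq> insert {#} (\<Union>k\<in>{1..n}. add_mset k ` partitions_of (n - k))"
  proof
    fix p assume p: "p \<in> partitions_of n"
    show "p \<in> insert {#} (\<Union>k\<in>{1..n}. add_mset k ` partitions_of (n - k))"
    proof (cases p)
      case empty
      then show ?thesis by simp
    next
      case (add k q)
      with p have "k \<in> {1..n}" "q \<in> partitions_of (n - k)"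
        by (auto simp: partitions_of_def)
      with add show ?thesis by blast
    qed
  qed
  moreover have "finite (\<Union>k\<in>{1..n}. add_mset k ` partitions_of (n - k))"
    using less by auto
  ultimately show ?case
    by (meson finite.insertI finite_subset)
qed

definition regular_partition :: "nat \<Rightarrow> nat multiset \<Rightarrow> bool" where
  "regular_partition l p \<longleftrightarrow> (\<forall>k\<in>#p. \<not> l dvd k)"

definition b6e :: "nat \<Rightarrow> nat" where
  "b6e n = card {p \<in> partitions_of n. regular_partition 6 p \<and> even (size p)}"

definition b6o :: "nat \<Rightarrow> nat" where
  "b6o n = card {p \<in> partitions_of n. regular_partition 6 p \<and> odd (size p)}"

definition parts_avoid_mod :: "int \<Rightarrow> int set \<Rightarrow> nat multiset \<Rightarrow> bool" where
  "parts_avoid_mod m R p \<longleftrightarrow> (\<forall>k\<in>#p. \<forall>r\<in>R. \<not> [int k = r] (mod m))"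

definition c48 :: "nat \<Rightarrow> nat" where
  "c48 n = card {p \<in> partitions_of n.
     parts_avoid_mod 48 {0, 2, -2, 20, -20, 22, -22, 24} p}"

(* The argument is an integer, so that d48 (int n - 2) makes sense for n < 2. *)
definition d48 :: "int \<Rightarrow> nat" where
  "d48 n = (if n < 0 then 0 else card {p \<in> partitions_of (nat n).
     parts_avoid_mod 48 {0, 4, -4, 10, -10, 14, -14, 24} p})"

end

theory Submission
  imports Defs "HOL-Computational_Algebra.Formal_Power_Series"
begin

text \<open>Since the number of even parts has the parity of the sum of the parts plus their number, it
  suffices to treat the 6-regular partitions with an even and with an odd number of even parts. The sum and
  the difference of these two counts have product generating functions. Multiplied by \<open>\<Prod>(1 - X\<^sup>k)\<close>,
  the sum becomes a pentagonal series, while the generating functions of \<open>c\<close> and \<open>d\<close> and the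
  difference become three instances of the quintuple product, each a difference of two series with quadratic
  exponents. Splitting the summation index by parity matches these series. The quintuple product is obtained
  from two Jacobi triple products by resumming over a sublattice of index 3, and the triple product is the
  limit of its finite form with Gaussian binomial coefficients.\<close>

unbundle fps_syntax

section \<open>Congruences modulo powers of the indeterminate, and infinite products\<close>

definition fps_cong :: "nat \<Rightarrow> 'a::comm_ring_1 fps \<Rightarrow> 'a fps \<Rightarrow> bool" where
  "fps_cong n F G \<longleftrightarrow> (\<forall>i<n. F $ i = G $ i)"

lemma fps_cong_refl [simp]: "fps_cong n F F"
  by (simp add: fps_cong_def)

lemma fps_cong_sym: "fps_cong n F G \<Longrightarrow> fps_cong n G F"
  by (simp add: fps_cong_def)

lemma fps_cong_trans: "fps_cong n F G \<Longrightarrow> fps_cong n G H \<Longrightarrow> fps_cong n F H"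
  by (simp add: fps_cong_def)

lemma fps_cong_mono: "fps_cong n F G \<Longrightarrow> m \<le> n \<Longrightarrow> fps_cong m F G"
  by (simp add: fps_cong_def)

lemma fps_cong_mult: "fps_cong n F G \<Longrightarrow> fps_cong n F' G' \<Longrightarrow> fps_cong n (F * F') (G * G')"
  by (auto simp: fps_cong_def fps_mult_nth intro!: sum.cong)

lemma fps_cong_sum: "(\<And>i. i \<in> A \<Longrightarrow> fps_cong n (f i) (g i)) \<Longrightarrow> fps_cong n (sum f A) (sum g A)"
  by (auto simp: fps_cong_def fps_sum_nth intro!: sum.cong)

lemma fps_cong_X_power_mult:
  assumes "fps_cong m F G"
  shows "fps_cong (m + k) (fps_X ^ k * F) (fps_X ^ k * G)"
  using assms by (auto simp: fps_cong_def fps_X_power_mult_nth)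

lemma fps_eqI_cong: "(\<And>n. fps_cong n F G) \<Longrightarrow> F = G"
  by (rule fps_ext) (auto simp: fps_cong_def)

section \<open>Infinite products of power series\<close>

definition fps_infprod :: "(nat \<Rightarrow> 'a::comm_ring_1 fps) \<Rightarrow> 'a fps" where
  "fps_infprod f = Abs_fps (\<lambda>n. (\<Prod>k=1..n. f k) $ n)"

text \<open>The \<open>k\<close>-th factor is 1 modulo \<open>X^k\<close>, so factors beyond
  \<open>n\<close> leave the coefficient of degree \<open>n\<close> alone. Under this condition
  \<open>fps_infprod\<close>, which reads that coefficient off the partial product up to
  \<open>n\<close>, is the genuine limit.\<close>

definition fps_prod_conv :: "(nat \<Rightarrow> 'a::comm_ring_1 fps) \<Rightarrow> bool" where
  "fps_prod_conv f \<longleftrightarrow> (\<forall>k\<ge>1. fps_cong k (f k) 1)"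

lemma fps_prod_cong_extend:
  assumes "fps_prod_conv f" "M \<le> N"
  shows "fps_cong (Suc M) (\<Prod>k=1..N. f k) (\<Prod>k=1..M. f k)"
  using assms(2)
proof (induction N rule: dec_induct)
  case (step N)
  have "fps_cong (Suc M) (f (Suc N)) 1"
    using assms(1) step by (auto simp: fps_prod_conv_def intro: fps_cong_mono)
  from fps_cong_mult[OF step.IH this] show ?case by simp
qed simp

lemma fps_infprod_cong:
  assumes "fps_prod_conv f"
  shows "fps_cong (Suc N) (fps_infprod f) (\<Prod>k=1..N. f k)"
  unfolding fps_cong_def
proof (intro allI impI)
  fix i assume "i < Suc N"
  with fps_prod_cong_extend[OF assms, of i N] show "fps_infprod f $ i = (\<Prod>k=1..N. f k) $ i"
    by (simp add: fps_infprod_def fps_cong_def)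
qed

lemma fps_infprod_eqI:
  assumes "fps_prod_conv f" and "\<And>N. \<exists>M\<ge>N. fps_cong (Suc N) (\<Prod>k=1..M. f k) F"
  shows "fps_infprod f = F"
proof (rule fps_ext)
  fix n
  obtain M where M: "M \<ge> n" "fps_cong (Suc n) (\<Prod>k=1..M. f k) F"
    using assms(2) by blast
  have "fps_infprod f $ n = (\<Prod>k=1..M. f k) $ n"
    using fps_infprod_cong[OF assms(1), of M] M(1) by (simp add: fps_cong_def)
  with M(2) show "fps_infprod f $ n = F $ n" by (simp add: fps_cong_def)
qed

lemma fps_prod_conv_mult:
  "fps_prod_conv f \<Longrightarrow> fps_prod_conv g \<Longrightarrow> fps_prod_conv (\<lambda>k. f k * g k)"
  unfolding fps_prod_conv_def by (metis fps_cong_mult mult_1)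

lemma fps_infprod_mult:
  assumes "fps_prod_conv f" "fps_prod_conv g"
  shows "fps_infprod (\<lambda>k. f k * g k) = fps_infprod f * fps_infprod g"
proof (rule fps_infprod_eqI)
  show "fps_prod_conv (\<lambda>k. f k * g k)"
    by (rule fps_prod_conv_mult[OF assms])
  show "\<exists>M\<ge>N. fps_cong (Suc N) (\<Prod>k=1..M. f k * g k) (fps_infprod f * fps_infprod g)" for N
    by (rule exI[of _ N])
       (simp only: prod.distrib order_refl fps_cong_mult[OF assms[THEN fps_infprod_cong, THEN fps_cong_sym]] simp_thms)
qed

lemma fps_infprod_nth_0 [simp]: "fps_infprod f $ 0 = 1"
  by (simp add: fps_infprod_def)

lemma fps_infprod_nonzero [simp]: "fps_infprod f \<noteq> 0"
  by (metis fps_infprod_nth_0 fps_zero_nth zero_neq_one)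

lemma fps_infprod_eq_cong: "(\<And>k. k \<ge> 1 \<Longrightarrow> f k = g k) \<Longrightarrow> fps_infprod f = fps_infprod g"
  unfolding fps_infprod_def by (metis (mono_tags, lifting) atLeastAtMost_iff prod.cong)

text \<open>Drops factors equal to 1: the sparse partial product up to \<open>\<phi> N\<close> is
  the dense one up to \<open>N\<close>, and \<open>\<phi> N >= N\<close> preserves the
  precision.\<close>

lemma fps_infprod_reindex:
  assumes mono: "strict_mono (\<phi> :: nat \<Rightarrow> nat)"
    and conv: "fps_prod_conv (\<lambda>k. if k \<in> \<phi> ` {1..} then g k else 1)"
  shows "fps_infprod (\<lambda>k. g (\<phi> k)) = fps_infprod (\<lambda>k. if k \<in> \<phi> ` {1..} then g k else 1)"
proof -
  let ?f = "\<lambda>k. if k \<in> \<phi> ` {1..} then g k else 1"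
  have ge: "\<phi> k \<ge> k" for k
    using mono by (rule strict_mono_imp_increasing)
  have conv': "fps_prod_conv (\<lambda>k. g (\<phi> k))"
    unfolding fps_prod_conv_def
  proof (intro allI impI)
    fix k :: nat assume "1 \<le> k"
    with ge[of k] have "fps_cong (\<phi> k) (?f (\<phi> k)) 1"
      using conv unfolding fps_prod_conv_def by (meson order_trans)
    with \<open>1 \<le> k\<close> show "fps_cong k (g (\<phi> k)) 1"
      using ge[of k] by (auto intro: fps_cong_mono)
  qed
  have eq: "(\<Prod>k=1..\<phi> N. ?f k) = (\<Prod>k=1..N. g (\<phi> k))" for N
  proof -
    have "(\<Prod>k=1..\<phi> N. ?f k) = (\<Prod>k\<in>{1..\<phi> N} \<inter> \<phi> ` {1..}. g k)"
      by (simp only: prod.inter_restrict finite_atLeastAtMost)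
    also have "{1..\<phi> N} \<inter> \<phi> ` {1..} = \<phi> ` {1..N}"
    proof (intro set_eqI iffI)
      fix l assume "l \<in> \<phi> ` {1..N}"
      then show "l \<in> {1..\<phi> N} \<inter> \<phi> ` {1..}"
        using strict_mono_less_eq[OF mono] order_trans[OF _ ge] by auto
    qed (auto simp: strict_mono_less_eq[OF mono])
    also have "prod g \<dots> = (\<Prod>k=1..N. g (\<phi> k))"
      by (subst prod.reindex) (simp_all only: strict_mono_imp_inj_on[OF mono] o_def)
    finally show ?thesis .
  qed
  show ?thesis
  proof (rule fps_infprod_eqI[OF conv', OF exI[of _ N for N], OF conjI[OF order_refl]])
    fix N
    have "fps_cong (Suc (\<phi> N)) (fps_infprod ?f) (\<Prod>k=1..N. g (\<phi> k))"
      using fps_infprod_cong[OF conv, of "\<phi> N"] eq by simp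
    then show "fps_cong (Suc N) (\<Prod>k=1..N. g (\<phi> k)) (fps_infprod ?f)"
      using ge[of N] by (blast intro: fps_cong_sym fps_cong_mono Suc_le_mono[THEN iffD2])
  qed
qed

section \<open>Euler products over sets of exponents\<close>

definition euler_prod :: "nat set \<Rightarrow> real fps" where
  "euler_prod S = fps_infprod (\<lambda>k. if k \<in> S then 1 - fps_X ^ k else 1)"

lemma fps_cong_one_minus [simp]: "n \<le> k \<Longrightarrow> fps_cong n (1 - fps_const c * fps_X ^ k) 1"
  by (auto simp: fps_cong_def fps_X_power_nth)

lemma fps_cong_one_minus' [simp]: "n \<le> k \<Longrightarrow> fps_cong n (1 - fps_X ^ k) 1"
  by (auto simp: fps_cong_def fps_X_power_nth)

lemma euler_prod_conv: "fps_prod_conv (\<lambda>k. if k \<in> S then 1 - fps_X ^ k else 1)"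
  by (simp add: fps_prod_conv_def)

lemma euler_prod_nonzero [simp]: "euler_prod S \<noteq> 0"
  by (simp add: euler_prod_def)

text \<open>Each factor \<open>1 - X^k\<close> occurs equally often on both sides; multiplicities
  are compared as numbers because a factor may occur twice. The product index starts at 1, so the
  sets may contain 0 freely.\<close>

lemma euler_prod_mult:
  assumes "\<And>k. k \<ge> 1 \<Longrightarrow> of_bool (k \<in> A) + of_bool (k \<in> B) = of_bool (k \<in> C) + (of_bool (k \<in> D) :: nat)"
  shows "euler_prod A * euler_prod B = euler_prod C * euler_prod D"
  unfolding euler_prod_def fps_infprod_mult[OF euler_prod_conv euler_prod_conv, symmetric]
proof (rule fps_infprod_eq_cong)
  fix k :: nat assume "k \<ge> 1"
  from assms[OF this] show "(if k \<in> A then 1 - fps_X ^ k else 1) * (if k \<in> B then 1 - fps_X ^ k else 1)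
     = (if k \<in> C then 1 - fps_X ^ k else 1) * (if k \<in> D then 1 - fps_X ^ k else (1 :: real fps))"
    by (auto simp: of_bool_def split: if_splits)
qed

lemma euler_prod_empty [simp]: "euler_prod {} = 1"
  by (simp add: euler_prod_def fps_infprod_def fps_eq_iff)

lemma euler_prod_Un:
  assumes "A \<inter> B = {}"
  shows "euler_prod (A \<union> B) = euler_prod A * euler_prod B"
proof -
  have "euler_prod A * euler_prod B = euler_prod (A \<union> B) * euler_prod {}"
    using assms by (intro euler_prod_mult) auto
  then show ?thesis by simp
qed

text \<open>The bounds make \<open>c\<close> the least positive member of its residue class;
  \<open>c = d\<close> covers the class of 0.\<close>

lemma euler_prod_progression:
  assumes "1 \<le> c" "c \<le> d"
  shows "fps_infprod (\<lambda>k. 1 - fps_X ^ (c + d * (k - 1))) = euler_prod {k. k mod d = c mod d}"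
proof -
  \<comment> \<open>Truncated subtraction gives \<open>c + d * (k - 1)\<close> the same value at 0
    and at 1. This variant is 0 at \<open>k = 0\<close>, hence strictly monotone.\<close>
  define \<phi> where "\<phi> = (\<lambda>k::nat. d * k - (d - c))"
  have \<phi>_pos: "\<phi> k = c + d * (k - 1)" if "k \<ge> 1" for k
    using that assms by (cases k) (auto simp: \<phi>_def)
  have mono: "strict_mono \<phi>"
    unfolding strict_mono_Suc_iff using assms by (auto simp: \<phi>_def)
  have range: "k \<in> \<phi> ` {1..} \<longleftrightarrow> k mod d = c mod d" if "k \<ge> 1" for k
  proof
    assume "k mod d = c mod d"
    moreover have "k \<ge> c"
    proof (rule ccontr)
      assume "\<not> k \<ge> c"
      with assms \<open>k \<ge> 1\<close> \<open>k mod d = c mod d\<close> show False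
        by (cases "c = d") auto
    qed
    ultimately obtain j where "k = c + d * j"
      by (metis mod_eq_nat1E)
    then have "k = \<phi> (Suc j)" by (simp add: \<phi>_pos)
    then show "k \<in> \<phi> ` {1..}" by auto
  qed (auto simp: \<phi>_pos)
  have "fps_infprod (\<lambda>k. 1 - fps_X ^ (c + d * (k - 1))) = fps_infprod (\<lambda>k. 1 - fps_X ^ \<phi> k :: real fps)"
    by (rule fps_infprod_eq_cong) (simp add: \<phi>_pos)
  also have "\<dots> = fps_infprod (\<lambda>k. if k \<in> \<phi> ` {1..} then 1 - fps_X ^ k else 1)"
    by (rule fps_infprod_reindex[OF mono]) (rule euler_prod_conv)
  also have "\<dots> = euler_prod {k. k mod d = c mod d}"
    unfolding euler_prod_def by (rule fps_infprod_eq_cong) (simp only: range mem_Collect_eq)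
  finally show ?thesis .
qed

section \<open>The Jacobi triple product\<close>

text \<open>The q-Pochhammer symbol (q; q)_n rather than the q-factorial; the powers of 1 - q by
  which they differ cancel in the Gaussian binomial.\<close>

definition gauss_fact :: "real fps \<Rightarrow> nat \<Rightarrow> real fps" where
  "gauss_fact q n = (\<Prod>k=1..n. 1 - q ^ k)"

definition gauss_binomial :: "real fps \<Rightarrow> nat \<Rightarrow> nat \<Rightarrow> real fps" where
  "gauss_binomial q n k =
     (if k \<le> n then gauss_fact q n * inverse (gauss_fact q k) * inverse (gauss_fact q (n - k)) else 0)"

lemma gauss_fact_0 [simp]: "gauss_fact q 0 = 1"
  by (simp add: gauss_fact_def)

lemma gauss_fact_Suc: "gauss_fact q (Suc n) = gauss_fact q n * (1 - q ^ Suc n)"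
  by (simp add: gauss_fact_def)

lemma gauss_fact_nth_0:
  assumes "q $ 0 = 0"
  shows "gauss_fact q n $ 0 = 1"
  by (induction n) (simp_all add: gauss_fact_Suc assms)

lemma gauss_fact_inverse:
  assumes "q $ 0 = 0"
  shows "gauss_fact q n * inverse (gauss_fact q n) = 1"
  by (simp add: inverse_mult_eq_1' gauss_fact_nth_0[OF assms])

lemma inverse_gauss_fact:
  assumes "q $ 0 = 0"
  shows "inverse (gauss_fact q n) = inverse (gauss_fact q (Suc n)) * (1 - q ^ Suc n)"
proof -
  have "(1 - q ^ Suc n) * inverse (1 - q ^ Suc n) = 1"
    using assms by (intro inverse_mult_eq_1') simp
  then show ?thesis
    by (simp add: gauss_fact_Suc fps_inverse_mult mult.assoc mult.commute)
qed

lemma gauss_binomial_0 [simp]: "q $ 0 = 0 \<Longrightarrow> gauss_binomial q n 0 = 1"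
  by (simp add: gauss_binomial_def gauss_fact_inverse)

lemma gauss_binomial_eq_0 [simp]: "n < k \<Longrightarrow> gauss_binomial q n k = 0"
  by (simp add: gauss_binomial_def)

lemma gauss_binomial_self [simp]: "q $ 0 = 0 \<Longrightarrow> gauss_binomial q n n = 1"
  by (simp add: gauss_binomial_def gauss_fact_inverse)

text \<open>With the common factor \<open>K\<close> extracted, both Pascal rules become polynomial
  identities such as 1 - q^(n+1) = (1 - q^(n-k)) + q^(n-k) (1 - q^(k+1)).\<close>

lemma gauss_binomial_factors:
  assumes q: "q $ 0 = 0" and "k < n"
  defines "K \<equiv> gauss_fact q n * inverse (gauss_fact q (Suc k)) * inverse (gauss_fact q (n - k))"
  shows "gauss_binomial q (Suc n) (Suc k) = K * (1 - q ^ Suc n)"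
    and "gauss_binomial q n (Suc k) = K * (1 - q ^ (n - k))"
    and "gauss_binomial q n k = K * (1 - q ^ Suc k)"
proof -
  have nk: "n - k = Suc (n - Suc k)" using \<open>k < n\<close> by simp
  show "gauss_binomial q (Suc n) (Suc k) = K * (1 - q ^ Suc n)"
    using \<open>k < n\<close> by (simp add: gauss_binomial_def K_def gauss_fact_Suc algebra_simps)
  show "gauss_binomial q n (Suc k) = K * (1 - q ^ (n - k))"
    using \<open>k < n\<close> inverse_gauss_fact[OF q, of "n - Suc k", folded nk]
    by (simp add: gauss_binomial_def K_def mult.assoc)
  show "gauss_binomial q n k = K * (1 - q ^ Suc k)"
    using \<open>k < n\<close> inverse_gauss_fact[OF q, of k]
    by (simp add: gauss_binomial_def K_def mult_ac)
qed

lemma gauss_binomial_Suc_Suc: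
  assumes q: "q $ 0 = 0" and "k \<le> n"
  shows "gauss_binomial q (Suc n) (Suc k) = gauss_binomial q n (Suc k) + q ^ (n - k) * gauss_binomial q n k"
proof (cases "k = n")
  case False
  with \<open>k \<le> n\<close> have "k < n" by simp
  have "q ^ (n - k) * q ^ Suc k = q ^ Suc n"
    using \<open>k < n\<close> by (simp flip: power_add power_Suc)
  from this[symmetric] show ?thesis
    unfolding gauss_binomial_factors[OF q \<open>k < n\<close>] by (simp add: algebra_simps del: power_Suc)
qed (simp add: q)

lemma gauss_binomial_Suc_Suc':
  assumes q: "q $ 0 = 0" and "k \<le> n"
  shows "gauss_binomial q (Suc n) (Suc k) = gauss_binomial q n k + q ^ Suc k * gauss_binomial q n (Suc k)"
proof (cases "k = n")
  case False
  with \<open>k \<le> n\<close> have "k < n" by simp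
  have "q ^ Suc k * q ^ (n - k) = q ^ Suc n"
    using \<open>k < n\<close> by (simp flip: power_add power_Suc)
  from this[symmetric] show ?thesis
    unfolding gauss_binomial_factors[OF q \<open>k < n\<close>] by (simp add: algebra_simps del: power_Suc)
qed (simp add: q)

lemma gauss_fact_fps_cong:
  assumes q: "fps_cong 1 q 0" and "r \<le> M"
  shows "fps_cong (Suc r) (gauss_fact q M) (gauss_fact q r)"
proof -
  have "fps_cong k (1 - q ^ k) 1" for k
    using q by (auto simp: fps_cong_def fps_power_zeroth intro: startsby_zero_power_prefix[rule_format])
  then show ?thesis
    unfolding gauss_fact_def
    by (intro fps_prod_cong_extend \<open>r \<le> M\<close>) (simp add: fps_prod_conv_def)
qed

lemma fps_cong_inverse:
  fixes F G :: "real fps"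
  assumes "fps_cong n F G" "F $ 0 \<noteq> 0" "G $ 0 \<noteq> 0"
  shows "fps_cong n (inverse F) (inverse G)"
proof -
  have "fps_cong n (F * (inverse F * inverse G)) (G * (inverse F * inverse G))"
    by (intro fps_cong_mult assms(1) fps_cong_refl)
  moreover have "F * (inverse F * inverse G) = inverse G"
    using assms(2) by (simp add: inverse_mult_eq_1' flip: mult.assoc)
  moreover have "G * (inverse F * inverse G) = inverse F"
    using assms(3) by (metis inverse_mult_eq_1' mult.left_commute mult.right_neutral)
  ultimately show ?thesis by (simp add: fps_cong_sym)
qed

text \<open>The indices \<open>n\<close>, \<open>2 * n\<close>, \<open>i\<close> and
  \<open>2 * n - i\<close> are all at least \<open>r\<close>, so modulo \<open>X^(r+1)\<close> all
  four factorials agree with that of index \<open>r\<close> and cancel.\<close>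

lemma gauss_binomial_central_fps_cong:
  assumes q: "fps_cong 1 q 0" and "i \<le> 2 * n" and "r \<le> i" "r + i \<le> 2 * n"
  shows "fps_cong (Suc r) (gauss_fact q n * gauss_binomial q (2 * n) i) 1"
proof -
  have q0: "q $ 0 = 0" using q by (simp add: fps_cong_def)
  have r: "r \<le> n" "r \<le> 2 * n" "r \<le> 2 * n - i" using assms by auto
  let ?P = "gauss_fact q"
  have "fps_cong (Suc r) (?P n * (?P (2*n) * inverse (?P i) * inverse (?P (2*n - i))))
          (?P r * (?P r * inverse (?P r) * inverse (?P r)))"
    by (intro fps_cong_mult fps_cong_inverse gauss_fact_fps_cong[OF q] r assms)
       (simp_all add: gauss_fact_nth_0 q0)
  also have "?P r * (?P r * inverse (?P r) * inverse (?P r)) = 1"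
    by (simp add: gauss_fact_inverse[OF q0])
  finally show ?thesis using assms(2) by (simp add: gauss_binomial_def)
qed

section \<open>Theta series and the finite triple product\<close>

definition alt_sign :: "int \<Rightarrow> real" where
  "alt_sign j = (if even j then 1 else - 1)"

text \<open>\<open>theta a b\<close> below is Ramanujan's \<open>f(- X\<^bsup>2a\<^esup>, - X\<^bsup>2b\<^esup>)\<close>; the doubling
  keeps the exponents \<open>a j (j + 1) + b j (j - 1)\<close> free of halves.\<close>

definition theta_exp :: "nat \<Rightarrow> nat \<Rightarrow> int \<Rightarrow> int" where
  "theta_exp a b j = int a * (j * (j + 1)) + int b * (j * (j - 1))"

definition theta_term :: "nat \<Rightarrow> nat \<Rightarrow> int \<Rightarrow> real fps" where
  "theta_term a b j = fps_const (alt_sign j) * fps_X ^ nat (theta_exp a b j)"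

lemma consecutive_mult_nonneg: "j * (j + 1) \<ge> 0" "j * (j - 1) \<ge> 0" for j :: int
  by (cases "j \<ge> 0"; simp add: zero_le_mult_iff; linarith)+

lemma theta_exp_nonneg: "theta_exp a b j \<ge> 0"
  by (simp add: theta_exp_def consecutive_mult_nonneg)

text \<open>Makes the fibres of the exponent finite, and later offsets the precision lost at the
  ends of the finite triple product.\<close>

lemma theta_exp_ge_abs:
  assumes "a \<ge> 1" "b \<ge> 1"
  shows "theta_exp a b j \<ge> \<bar>j\<bar>"
proof -
  have "theta_exp a b j \<ge> 1 * (j * (j + 1)) + 1 * (j * (j - 1))"
    unfolding theta_exp_def using assms
    by (intro add_mono mult_right_mono consecutive_mult_nonneg) auto
  also have "1 * (j * (j + 1)) + 1 * (j * (j - 1)) = 2 * (\<bar>j\<bar> * \<bar>j\<bar>)"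
    by (simp add: algebra_simps)
  finally have "theta_exp a b j \<ge> 2 * (\<bar>j\<bar> * \<bar>j\<bar>)" .
  moreover have "\<bar>j\<bar> * \<bar>j\<bar> \<ge> \<bar>j\<bar>"
    using mult_right_mono[of 1 "\<bar>j\<bar>" "\<bar>j\<bar>"] by (cases "j = 0") auto
  ultimately show ?thesis by linarith
qed

text \<open>From \<open>j\<close> to \<open>j + 1\<close> the exponent grows by 2a + 2(a+b)j. Hence
  the monomial of a new factor moves a term to its neighbour, and the power of q left over is the
  weight in a Pascal rule.\<close>

lemma theta_term_up:
  assumes "i \<le> m + n"
  shows "fps_X ^ (2*a) * (fps_X ^ (2*(a+b))) ^ m * theta_term a b (int i - int n)
       = - ((fps_X ^ (2*(a+b))) ^ (m + n - i) * theta_term a b (int (Suc i) - int n))"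
proof -
  have "int (2*a + 2*(a+b)*m) + theta_exp a b (int i - int n)
      = int (2*(a+b)*(m+n-i)) + theta_exp a b (int (Suc i) - int n)"
    using assms by (simp add: theta_exp_def of_nat_diff) (simp add: algebra_simps)
  then have "2*a + 2*(a+b)*m + nat (theta_exp a b (int i - int n))
      = 2*(a+b)*(m+n-i) + nat (theta_exp a b (int (Suc i) - int n))"
    using theta_exp_nonneg[of a b "int i - int n"] theta_exp_nonneg[of a b "int (Suc i) - int n"]
    by linarith
  moreover have "alt_sign (int (Suc i) - int n) = - alt_sign (int i - int n)"
    by (simp add: alt_sign_def)
  ultimately show ?thesis
    unfolding theta_term_def
    by (simp only: fps_const_neg[symmetric] mult_minus_left mult_minus_right minus_minus
          mult.left_commute[of _ "fps_const _"] power_mult[symmetric] power_add[symmetric])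
qed

lemma theta_term_down:
  "fps_X ^ (2*b) * (fps_X ^ (2*(a+b))) ^ n * theta_term a b (int i - int n)
       = - ((fps_X ^ (2*(a+b))) ^ i * theta_term a b (int i - int (Suc n)))"
proof -
  have "int (2*b + 2*(a+b)*n) + theta_exp a b (int i - int n)
      = int (2*(a+b)*i) + theta_exp a b (int i - int (Suc n))"
    by (simp add: theta_exp_def algebra_simps)
  then have "2*b + 2*(a+b)*n + nat (theta_exp a b (int i - int n))
      = 2*(a+b)*i + nat (theta_exp a b (int i - int (Suc n)))"
    using theta_exp_nonneg[of a b "int i - int n"] theta_exp_nonneg[of a b "int i - int (Suc n)"]
    by linarith
  moreover have "alt_sign (int i - int (Suc n)) = - alt_sign (int i - int n)"
    by (simp add: alt_sign_def)
  ultimately show ?thesis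
    unfolding theta_term_def
    by (simp only: fps_const_neg[symmetric] mult_minus_left mult_minus_right minus_minus
          mult.left_commute[of _ "fps_const _"] power_mult[symmetric] power_add[symmetric])
qed

text \<open>A form of the q-binomial theorem, by induction on \<open>n\<close> with the first
  product empty and then on \<open>m\<close>. A new factor adds a copy of the sum with its index
  shifted by one; \<open>gauss_binomial_Suc_Suc'\<close> recombines the two copies for
  \<open>n\<close>, \<open>gauss_binomial_Suc_Suc\<close> for \<open>m\<close>.\<close>

lemma finite_jacobi_triple_product:
  fixes a b :: nat
  defines "q \<equiv> fps_X ^ (2*(a+b)) :: real fps"
  assumes "a + b > 0"
  shows "(\<Prod>k<m. 1 - fps_X ^ (2*a) * q ^ k) * (\<Prod>k<n. 1 - fps_X ^ (2*b) * q ^ k)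
       = (\<Sum>i\<le>m+n. gauss_binomial q (m+n) i * theta_term a b (int i - int n))"
proof -
  have q0: "q $ 0 = 0" using assms by simp
  let ?T = "\<lambda>i n. theta_term a b (int i - int n)"
  \<comment> \<open>Padding with the vanishing term at \<open>Suc N\<close> lets the unshifted sum
    run over successor indices, as the shifted one does.\<close>
  have extend: "(\<Sum>i\<le>N. gauss_binomial q N i * f i)
      = f 0 + (\<Sum>i\<le>N. gauss_binomial q N (Suc i) * f (Suc i))" for N and f :: "nat \<Rightarrow> real fps"
  proof -
    have "(\<Sum>i\<le>N. gauss_binomial q N i * f i) = (\<Sum>i\<le>Suc N. gauss_binomial q N i * f i)"
      by simp
    also have "\<dots> = f 0 + (\<Sum>i\<le>N. gauss_binomial q N (Suc i) * f (Suc i))"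
      by (subst sum.atMost_Suc_shift) (simp add: q0)
    finally show ?thesis .
  qed
  have factor: "(\<Sum>i\<le>N. g i * t i) * (1 - y) = (\<Sum>i\<le>N. g i * t i) - (\<Sum>i\<le>N. g i * (y * t i))"
    for N and g t :: "nat \<Rightarrow> real fps" and y
    by (simp add: right_diff_distrib left_diff_distrib sum_subtractf sum_distrib_left sum_distrib_right mult_ac)
  have split: "(\<Sum>i\<le>Suc N. gauss_binomial q (Suc N) i * f i)
      = f 0 + (\<Sum>i\<le>N. gauss_binomial q (Suc N) (Suc i) * f (Suc i))" for N and f :: "nat \<Rightarrow> real fps"
    by (subst sum.atMost_Suc_shift) (simp add: q0)
  have base: "(\<Prod>k<n. 1 - fps_X ^ (2*b) * q ^ k) = (\<Sum>i\<le>n. gauss_binomial q n i * ?T i n)" for n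
  proof (induction n)
    case 0
    show ?case by (simp add: theta_term_def theta_exp_def alt_sign_def q0)
  next
    case (Suc n)
    have "(\<Prod>k<Suc n. 1 - fps_X ^ (2*b) * q ^ k)
        = (\<Sum>i\<le>n. gauss_binomial q n i * ?T i n) * (1 - fps_X ^ (2*b) * q ^ n)"
      by (simp add: Suc.IH)
    also have "\<dots> = (\<Sum>i\<le>n. gauss_binomial q n i * ?T i n)
        - (\<Sum>i\<le>n. gauss_binomial q n i * (fps_X ^ (2*b) * q ^ n * ?T i n))"
      by (rule factor)
    also have "\<dots> = (\<Sum>i\<le>n. gauss_binomial q n i * ?T i n)
        + (\<Sum>i\<le>n. gauss_binomial q n i * (q ^ i * ?T i (Suc n)))"
      unfolding q_def theta_term_down by (simp add: sum_negf)
    \<comment> \<open>Since \<open>?T i n\<close> equals \<open>?T (Suc i) (Suc n)\<close>, the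
      first sum is already indexed by successors; \<open>extend\<close> brings the second into this
      form.\<close>
    also have "\<dots> = (\<Sum>i\<le>Suc n. gauss_binomial q (Suc n) i * ?T i (Suc n))"
      unfolding split extend[of n "\<lambda>i. q ^ i * ?T i (Suc n)"]
      by (simp add: gauss_binomial_Suc_Suc'[OF q0] ring_distribs sum.distrib mult_ac)
    finally show ?case .
  qed
  show ?thesis
  proof (induction m)
    case 0
    show ?case using base by simp
  next
    case (Suc m)
    let ?N = "m + n"
    have "(\<Prod>k<Suc m. 1 - fps_X ^ (2*a) * q ^ k) * (\<Prod>k<n. 1 - fps_X ^ (2*b) * q ^ k)
        = (\<Sum>i\<le>?N. gauss_binomial q ?N i * ?T i n) * (1 - fps_X ^ (2*a) * q ^ m)"
      by (simp add: Suc.IH[symmetric] mult_ac)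
    also have "\<dots> = (\<Sum>i\<le>?N. gauss_binomial q ?N i * ?T i n)
        - (\<Sum>i\<le>?N. gauss_binomial q ?N i * (fps_X ^ (2*a) * q ^ m * ?T i n))"
      by (rule factor)
    also have "(\<Sum>i\<le>?N. gauss_binomial q ?N i * (fps_X ^ (2*a) * q ^ m * ?T i n))
        = - (\<Sum>i\<le>?N. gauss_binomial q ?N i * (q ^ (?N - i) * ?T (Suc i) n))"
      unfolding sum_negf[symmetric] q_def
      by (rule sum.cong) (simp_all only: theta_term_up atMost_iff mult_minus_right)
    also have "(\<Sum>i\<le>?N. gauss_binomial q ?N i * ?T i n)
        - - (\<Sum>i\<le>?N. gauss_binomial q ?N i * (q ^ (?N - i) * ?T (Suc i) n))
        = (\<Sum>i\<le>Suc ?N. gauss_binomial q (Suc ?N) i * ?T i n)"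
      unfolding split extend[of ?N "\<lambda>i. ?T i n"]
      by (simp add: gauss_binomial_Suc_Suc[OF q0] ring_distribs sum.distrib mult_ac)
    finally show ?case by simp
  qed
qed

section \<open>Formal sums graded by an integer exponent\<close>

definition graded_sum :: "'i set \<Rightarrow> ('i \<Rightarrow> real) \<Rightarrow> ('i \<Rightarrow> int) \<Rightarrow> real fps" where
  "graded_sum I c e = Abs_fps (\<lambda>n. \<Sum>i | i \<in> I \<and> e i = int n. c i)"

text \<open>Excludes the two ways in which \<open>graded_sum\<close> would lose terms: an infinite
  fibre, whose sum is 0 by convention, and a negative exponent.\<close>

definition graded_finite :: "'i set \<Rightarrow> ('i \<Rightarrow> int) \<Rightarrow> bool" where
  "graded_finite I e \<longleftrightarrow> (\<forall>n. finite {i \<in> I. e i = n}) \<and> (\<forall>i\<in>I. e i \<ge> 0)"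

definition theta :: "nat \<Rightarrow> nat \<Rightarrow> real fps" where
  "theta a b = graded_sum UNIV alt_sign (theta_exp a b)"

lemma theta_exp_fibre:
  assumes "a \<ge> 1" "b \<ge> 1"
  shows "{j. theta_exp a b j = n} \<subseteq> {-n..n}"
proof
  fix j assume "j \<in> {j. theta_exp a b j = n}"
  then show "j \<in> {-n..n}" using theta_exp_ge_abs[OF assms, of j] by auto
qed

lemma theta_graded_finite: "a \<ge> 1 \<Longrightarrow> b \<ge> 1 \<Longrightarrow> graded_finite UNIV (theta_exp a b)"
  by (auto simp: graded_finite_def theta_exp_nonneg intro: finite_subset[OF theta_exp_fibre])

text \<open>Indices outside \<open>{-n..n}\<close> have exponents above \<open>n\<close>.\<close>

lemma theta_fps_cong:
  assumes ab: "a \<ge> 1" "b \<ge> 1"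
  shows "fps_cong (Suc n) (\<Sum>i\<le>2*n. theta_term a b (int i - int n)) (theta a b)"
  unfolding fps_cong_def
proof (intro allI impI)
  fix l assume l: "l < Suc n"
  have nth: "theta_term a b j $ l = (if theta_exp a b j = int l then alt_sign j else 0)" for j
    using theta_exp_nonneg[of a b j] by (auto simp: theta_term_def fps_X_power_nth)
  have "(\<Sum>i\<le>2*n. theta_term a b (int i - int n)) $ l
      = (\<Sum>j\<in>{- int n..int n}. theta_term a b j $ l)"
    unfolding fps_sum_nth
    by (rule sum.reindex_bij_witness[where i = "\<lambda>j. nat (j + int n)" and j = "\<lambda>i. int i - int n"]) auto
  also have "\<dots> = (\<Sum>j | j \<in> {- int n..int n} \<and> theta_exp a b j = int l. alt_sign j)"
    unfolding nth by (subst sum.inter_filter) auto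
  also have "{j \<in> {- int n..int n}. theta_exp a b j = int l} = {j. theta_exp a b j = int l}"
    using theta_exp_fibre[OF ab, of "int l"] l by fastforce
  finally show "(\<Sum>i\<le>2*n. theta_term a b (int i - int n)) $ l = theta a b $ l"
    by (simp add: theta_def graded_sum_def)
qed

text \<open>The limit of the finite form with \<open>m = n\<close>, multiplied by
  \<open>gauss_fact q n\<close> so that the binomial coefficients tend to 1. The residue classes
  stay in separate products since two of them coincide when \<open>a = b\<close>.\<close>

theorem jacobi_triple_product:
  assumes ab: "a \<ge> 1" "b \<ge> 1"
  shows "theta a b = euler_prod {k. 2*(a+b) dvd k}
    * euler_prod {k. k mod (2*(a+b)) = 2*a mod (2*(a+b))} * euler_prod {k. k mod (2*(a+b)) = 2*b mod (2*(a+b))}"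
proof -
  let ?M = "2 * (a + b)"
  define q :: "real fps" where "q = fps_X ^ ?M"
  let ?F = "\<lambda>c k. 1 - fps_X ^ (c + ?M * (k - 1)) :: real fps"
  let ?f = "\<lambda>k. ?F ?M k * ?F (2*a) k * ?F (2*b) k"
  have conv: "fps_prod_conv (?F c)" if "c \<ge> 1" for c
    unfolding fps_prod_conv_def
  proof (intro allI impI fps_cong_one_minus')
    fix k :: nat assume "k \<ge> 1"
    moreover have "k - 1 \<le> ?M * (k - 1)" using ab by simp
    ultimately show "k \<le> c + ?M * (k - 1)" using that by linarith
  qed
  have q: "fps_cong 1 q 0" "a + b > 0" using ab by (auto simp: q_def fps_cong_def)
  have shift: "(\<Prod>k=1..n. ?F c k) = (\<Prod>k<n. 1 - fps_X ^ c * q ^ k)" for c n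
    by (rule prod.reindex_bij_witness[where i = Suc and j = "\<lambda>k. k - 1"])
       (auto simp: q_def power_add power_mult)
  have euler: "(\<Prod>k=1..n. ?F ?M k) = gauss_fact q n" for n
    unfolding gauss_fact_def
  proof (rule prod.cong[OF refl])
    fix k assume "k \<in> {1..n}"
    then have "?M + ?M * (k - 1) = ?M * k" by (cases k) auto
    then show "?F ?M k = 1 - q ^ k" by (simp add: q_def power_mult)
  qed
  have partial: "(\<Prod>k=1..n. ?f k)
      = (\<Sum>i\<le>2*n. (gauss_fact q n * gauss_binomial q (2*n) i) * theta_term a b (int i - int n))" for n
  proof -
    have "(\<Prod>k=1..n. ?f k) = (\<Prod>k=1..n. ?F ?M k) * ((\<Prod>k=1..n. ?F (2*a) k) * (\<Prod>k=1..n. ?F (2*b) k))"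
      by (simp only: prod.distrib mult.assoc)
    also have "\<dots> = gauss_fact q n * (\<Sum>i\<le>n+n. gauss_binomial q (n+n) i * theta_term a b (int i - int n))"
      by (simp only: euler shift finite_jacobi_triple_product[OF q(2), folded q_def])
    finally show ?thesis by (simp only: sum_distrib_left mult_2[of n] mult.assoc)
  qed
  have "fps_infprod ?f = theta a b"
  proof (rule fps_infprod_eqI)
    show "fps_prod_conv ?f"
      using ab by (intro fps_prod_conv_mult conv) auto
    fix n
    have "fps_cong (Suc n) (\<Prod>k=1..n. ?f k) (\<Sum>i\<le>2*n. theta_term a b (int i - int n))"
      unfolding partial
    proof (rule fps_cong_sum)
      fix i assume i: "i \<in> {..2*n}"
      \<comment> \<open>The coefficient is 1 only modulo \<open>X^(r+1)\<close>, which is weak near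
        the ends of the range. There the exponent helps: it is at least |i - n| = n - r, so the
        product is right through degree \<open>n\<close>.\<close>
      define r where "r = min i (2 * n - i)"
      let ?e = "theta_exp a b (int i - int n)"
      have "fps_cong (Suc r) (gauss_fact q n * gauss_binomial q (2*n) i) 1"
        using i by (intro gauss_binomial_central_fps_cong q) (auto simp: r_def)
      then have "fps_cong (Suc r) (gauss_fact q n * gauss_binomial q (2*n) i
            * fps_const (alt_sign (int i - int n))) (1 * fps_const (alt_sign (int i - int n)))"
        by (intro fps_cong_mult fps_cong_refl)
      from fps_cong_X_power_mult[OF this, of "nat ?e"]
      have "fps_cong (Suc r + nat ?e)
              (gauss_fact q n * gauss_binomial q (2*n) i * theta_term a b (int i - int n))
              (theta_term a b (int i - int n))"
        by (simp add: theta_term_def mult_ac)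
      moreover have "Suc n \<le> Suc r + nat ?e"
        using theta_exp_ge_abs[OF ab, of "int i - int n"] i by (auto simp: r_def min_def)
      ultimately show "fps_cong (Suc n)
              (gauss_fact q n * gauss_binomial q (2*n) i * theta_term a b (int i - int n))
              (theta_term a b (int i - int n))"
        by (rule fps_cong_mono)
    qed
    from fps_cong_trans[OF this theta_fps_cong[OF ab]]
    show "\<exists>M\<ge>n. fps_cong (Suc n) (\<Prod>k=1..M. ?f k) (theta a b)" by blast
  qed
  moreover have "fps_infprod ?f = fps_infprod (?F ?M) * fps_infprod (?F (2*a)) * fps_infprod (?F (2*b))"
  proof -
    have "fps_infprod ?f = fps_infprod (\<lambda>k. ?F ?M k * ?F (2*a) k) * fps_infprod (?F (2*b))"
      using ab by (intro fps_infprod_mult fps_prod_conv_mult conv) auto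
    also have "fps_infprod (\<lambda>k. ?F ?M k * ?F (2*a) k) = fps_infprod (?F ?M) * fps_infprod (?F (2*a))"
      using ab by (intro fps_infprod_mult conv) auto
    finally show ?thesis .
  qed
  moreover have "fps_infprod (?F c) = euler_prod {k. k mod ?M = c mod ?M}" if "1 \<le> c" "c \<le> ?M" for c
    using that by (rule euler_prod_progression)
  ultimately show ?thesis using ab by (simp add: dvd_eq_mod_eq_0)
qed

section \<open>Formal sums and the quintuple product\<close>

lemma graded_finite_inj:
  assumes "graded_finite I e" "inj_on \<phi> J" "\<phi> ` J \<subseteq> I" "\<And>j. j \<in> J \<Longrightarrow> e (\<phi> j) = f j"
  shows "graded_finite J f"
  unfolding graded_finite_def
proof (intro conjI allI ballI)
  fix n
  have "\<phi> ` {j \<in> J. f j = n} \<subseteq> {i \<in> I. e i = n}"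
    using assms(3,4) by auto
  moreover have "inj_on \<phi> {j \<in> J. f j = n}"
    using assms(2) by (rule inj_on_subset) auto
  ultimately show "finite {j \<in> J. f j = n}"
    using assms(1) unfolding graded_finite_def by (meson inj_on_finite)
next
  fix j assume "j \<in> J"
  then show "f j \<ge> 0"
    using assms(1,3,4)[unfolded graded_finite_def] by force
qed

lemma graded_finite_subset: "graded_finite I e \<Longrightarrow> J \<subseteq> I \<Longrightarrow> graded_finite J e"
  by (rule graded_finite_inj[of I e id]) auto

lemma graded_sum_reindex:
  assumes "bij_betw \<phi> J I" "\<And>j. j \<in> J \<Longrightarrow> c (\<phi> j) = d j" "\<And>j. j \<in> J \<Longrightarrow> e (\<phi> j) = f j"
  shows "graded_sum I c e = graded_sum J d f"
  unfolding graded_sum_def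
proof (rule arg_cong[where f = Abs_fps], rule ext)
  fix n
  have "bij_betw \<phi> {j \<in> J. f j = int n} {i \<in> I. e i = int n}"
    using assms(1,3) by (auto simp: bij_betw_def inj_on_def)
  from sum.reindex_bij_betw[OF this, of c]
  show "(\<Sum>i | i \<in> I \<and> e i = int n. c i) = (\<Sum>j | j \<in> J \<and> f j = int n. d j)"
    using assms(2) by (metis (mono_tags, lifting) mem_Collect_eq sum.cong)
qed

lemma graded_sum_Un:
  assumes "graded_finite (I \<union> J) e" "I \<inter> J = {}"
  shows "graded_sum (I \<union> J) c e = graded_sum I c e + graded_sum J c e"
proof (rule fps_ext)
  fix n
  have "{i \<in> I \<union> J. e i = int n} = {i \<in> I. e i = int n} \<union> {i \<in> J. e i = int n}" by auto
  moreover have "finite {i \<in> I \<union> J. e i = int n}"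
    using assms(1) by (simp add: graded_finite_def)
  ultimately show "graded_sum (I \<union> J) c e $ n = (graded_sum I c e + graded_sum J c e) $ n"
    using assms(2) by (simp add: graded_sum_def) (subst sum.union_disjoint; auto)
qed

lemma graded_sum_uminus: "graded_sum I (\<lambda>i. - c i) e = - graded_sum I c e"
  by (rule fps_ext) (simp add: graded_sum_def sum_negf)

lemma graded_sum_shift:
  assumes "\<And>i. i \<in> I \<Longrightarrow> e i \<ge> 0"
  shows "fps_X ^ k * graded_sum I c e = graded_sum I c (\<lambda>i. e i + int k)"
proof (rule fps_ext)
  fix n
  show "(fps_X ^ k * graded_sum I c e) $ n = graded_sum I c (\<lambda>i. e i + int k) $ n"
  proof (cases "n < k")
    case True
    then have "{i \<in> I. e i + int k = int n} = {}" using assms by fastforce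
    with True show ?thesis by (simp only: graded_sum_def fps_X_power_mult_nth fps_nth_Abs_fps sum.empty if_True)
  next
    case False
    then have "{i \<in> I. e i + int k = int n} = {i \<in> I. e i = int (n - k)}" by auto
    with False show ?thesis by (simp add: graded_sum_def fps_X_power_mult_nth)
  qed
qed

text \<open>Nonnegativity of both exponents confines the first one to \<open>{0..n}\<close>, so the
  union is finite.\<close>

lemma product_fibre:
  assumes "graded_finite I e" "graded_finite J f"
  shows "{p \<in> I \<times> J. e (fst p) + f (snd p) = n}
       = (\<Union>t\<in>{0..n}. {i \<in> I. e i = t} \<times> {j \<in> J. f j = n - t})"
  using assms by (auto simp: graded_finite_def)

lemma graded_finite_prod:
  assumes "graded_finite I e" "graded_finite J f"
  shows "graded_finite (I \<times> J) (\<lambda>p. e (fst p) + f (snd p))"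
  using assms unfolding graded_finite_def product_fibre[OF assms]
  by (auto intro!: finite_UN_I finite_cartesian_product)

lemma graded_sum_mult:
  assumes "graded_finite I e" "graded_finite J f"
  shows "graded_sum I c e * graded_sum J d f
    = graded_sum (I \<times> J) (\<lambda>p. c (fst p) * d (snd p)) (\<lambda>p. e (fst p) + f (snd p))"
proof (rule fps_ext)
  fix n
  let ?A = "\<lambda>t. {i \<in> I. e i = t}" and ?B = "\<lambda>t. {j \<in> J. f j = t}"
  have fin: "finite (?A t)" "finite (?B t)" for t
    using assms by (auto simp: graded_finite_def)
  have "(graded_sum I c e * graded_sum J d f) $ n
      = (\<Sum>t=0..n. (\<Sum>i\<in>?A (int t). c i) * (\<Sum>j\<in>?B (int (n - t)). d j))"
    by (simp add: graded_sum_def fps_mult_nth)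
  also have "\<dots> = (\<Sum>t=0..n. (\<Sum>i\<in>?A (int t). c i) * (\<Sum>j\<in>?B (int n - int t). d j))"
    by (intro sum.cong) (auto simp: of_nat_diff)
  also have "\<dots> = (\<Sum>t\<in>{0..int n}. (\<Sum>i\<in>?A t. c i) * (\<Sum>j\<in>?B (int n - t). d j))"
    by (rule sum.reindex_bij_witness[where i = nat and j = int]) auto
  also have "\<dots> = (\<Sum>t\<in>{0..int n}. \<Sum>p\<in>?A t \<times> ?B (int n - t). c (fst p) * d (snd p))"
    by (simp add: sum_product sum.cartesian_product case_prod_beta)
  also have "\<dots> = (\<Sum>p\<in>(\<Union>t\<in>{0..int n}. ?A t \<times> ?B (int n - t)). c (fst p) * d (snd p))"
    by (rule sum.UNION_disjoint[symmetric]) (auto simp: fin)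
  also have "\<dots> = graded_sum (I \<times> J) (\<lambda>p. c (fst p) * d (snd p)) (\<lambda>p. e (fst p) + f (snd p)) $ n"
    by (simp add: graded_sum_def product_fibre[OF assms, symmetric])
  finally show "(graded_sum I c e * graded_sum J d f) $ n = \<dots>" .
qed

text \<open>Reindexing along \<open>\<sigma>\<close> shows that the series is its own
  negative.\<close>

lemma graded_sum_eq_0:
  assumes "bij_betw \<sigma> I I" "\<And>i. i \<in> I \<Longrightarrow> c (\<sigma> i) = - c i" "\<And>i. i \<in> I \<Longrightarrow> e (\<sigma> i) = e i"
  shows "graded_sum I c e = 0"
proof -
  have "graded_sum I c e = graded_sum I (\<lambda>i. - c i) e"
    by (rule graded_sum_reindex[where \<phi> = \<sigma>]) (use assms in auto)
  then have "graded_sum I c e $ n = - (graded_sum I c e $ n)" for n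
    by (simp add: graded_sum_uminus flip: fps_neg_nth)
  then show ?thesis by (intro fps_ext) (simp add: equal_neg_zero)
qed

section \<open>The quintuple product\<close>

definition quint1_exp :: "nat \<Rightarrow> nat \<Rightarrow> int \<Rightarrow> int" where
  "quint1_exp h a k = int h * (3 * k\<^sup>2 + k) - 6 * int a * k"

text \<open>With q = X^(2h) and z = X^(2a), \<open>quint1_exp\<close> and \<open>quint2_exp\<close>
  are the exponents of the two parts of the quintuple series, the sum of q^(k(3k+1)/2) (z^(-3k) -
  z^(3k+1)) over all integers k.\<close>

definition quint2_exp :: "nat \<Rightarrow> nat \<Rightarrow> int \<Rightarrow> int" where
  "quint2_exp h a k = int h * (3 * k\<^sup>2 + k) + 6 * int a * k + 2 * int a"

text \<open>The product of the two theta series on the left is a sum over pairs \<open>(m, n)\<close> of integers; it is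
  split according to \<open>m + 2 n\<close> modulo 3. Two residue classes factor through a pentagonal series, and
  the third one vanishes by the symmetry \<open>p \<mapsto> 1 - p\<close>.\<close>

lemma
  assumes \<alpha>: "a \<ge> 1" "2 * a < h"
  shows quint1_graded_finite: "graded_finite UNIV (quint1_exp h a)" (is ?fin1)
    and quint2_graded_finite: "graded_finite UNIV (quint2_exp h a)" (is ?fin2)
    and quintuple_product: "theta (h - a) a * theta (h - 2 * a) (h + 2 * a)
       = theta (2 * h) (4 * h) * (graded_sum UNIV (\<lambda>_. 1) (quint1_exp h a) - graded_sum UNIV (\<lambda>_. 1) (quint2_exp h a))"
proof -
  define e where "e = (\<lambda>x. theta_exp (h - a) a (fst x) + theta_exp (h - 2 * a) (h + 2 * a) (snd x))"
  define c where "c = (\<lambda>x. alt_sign (fst x) * alt_sign (snd x))"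
  define I where "I = (\<lambda>r. {x :: int \<times> int. (fst x + 2 * snd x) mod 3 = r})"
  \<comment> \<open>The quadratic part of the exponent at (m, n) is h(m^2 + 2n^2). The substitution
    m = k - 2p, n = k + p turns it into h(3k^2 + 6p^2) without a mixed term and reaches the residue
    class 0. \<open>\<phi>1\<close> is a translate for class 1, and \<open>\<phi>2\<close> is the
    negative of \<open>\<phi>1\<close>.\<close>
  define \<phi>0 where "\<phi>0 = (\<lambda>x :: int \<times> int. (fst x - 2 * snd x, fst x + snd x))"
  define \<phi>1 where "\<phi>1 = (\<lambda>x :: int \<times> int. (fst x + 1 - 2 * snd x, fst x + snd x))"
  define \<phi>2 where "\<phi>2 = (\<lambda>x :: int \<times> int. (2 * snd x - fst x - 1, - fst x - snd x))"
  let ?pent = "theta_exp (2 * h) (4 * h)"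
  have e: "graded_finite UNIV e"
    unfolding e_def UNIV_Times_UNIV[symmetric]
    using \<alpha> by (intro graded_finite_prod theta_graded_finite) auto
  have pent: "graded_finite UNIV ?pent"
    using \<alpha> by (intro theta_graded_finite) auto
  have h: "int (h - a) = int h - int a" "int (h - 2 * a) = int h - 2 * int a"
    using \<alpha> by (simp_all add: of_nat_diff)
  have e0: "e (\<phi>0 x) = quint1_exp h a (fst x) + ?pent (snd x)" for x
    unfolding e_def \<phi>0_def quint1_exp_def theta_exp_def h by (simp add: algebra_simps power2_eq_square)
  have e2: "e (\<phi>2 x) = quint2_exp h a (fst x) + ?pent (snd x)" for x
    unfolding e_def \<phi>2_def quint2_exp_def theta_exp_def h by (simp add: algebra_simps power2_eq_square)
  have e1: "e (\<phi>1 (k, 1 - p)) = e (\<phi>1 (k, p))" for k p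
    unfolding e_def \<phi>1_def theta_exp_def h by (simp add: algebra_simps power2_eq_square)
  have c0: "c (\<phi>0 x) = 1 * alt_sign (snd x)" and c1: "c (\<phi>1 (k, 1 - p)) = - c (\<phi>1 (k, p))"
    and c2: "c (\<phi>2 x) = - (1 * alt_sign (snd x))" for x k p
    by (auto simp: c_def \<phi>0_def \<phi>1_def \<phi>2_def alt_sign_def)
  have b0: "bij_betw \<phi>0 UNIV (I 0)"
    by (rule bij_betw_byWitness[where f' = "\<lambda>x. ((fst x + 2 * snd x) div 3, snd x - (fst x + 2 * snd x) div 3)"];
        auto simp: \<phi>0_def I_def; presburger)
  have b1: "bij_betw \<phi>1 UNIV (I 1)"
    by (rule bij_betw_byWitness[where f' = "\<lambda>x. ((fst x + 2 * snd x) div 3, snd x - (fst x + 2 * snd x) div 3)"];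
        auto simp: \<phi>1_def I_def; presburger)
  have b2: "bij_betw \<phi>2 UNIV (I 2)"
    by (rule bij_betw_byWitness[where f' = "\<lambda>x. (- ((fst x + 2 * snd x + 1) div 3), (fst x + 2 * snd x + 1) div 3 - snd x)"];
        auto simp: \<phi>2_def I_def; presburger)
  \<comment> \<open>On the line p = 0 the pentagonal exponent vanishes, so the quintuple exponents
    inherit finiteness from \<open>e\<close>.\<close>
  have inj: "inj_on (\<lambda>k. \<phi>0 (k, 0)) UNIV" "inj_on (\<lambda>k. \<phi>2 (k, 0)) UNIV"
    by (auto simp: inj_on_def \<phi>0_def \<phi>2_def)
  show fin1: ?fin1
    by (rule graded_finite_inj[OF e inj(1)]) (simp_all add: e0 theta_exp_def)
  show fin2: ?fin2
    by (rule graded_finite_inj[OF e inj(2)]) (simp_all add: e2 theta_exp_def)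
  have "theta (h - a) a * theta (h - 2 * a) (h + 2 * a) = graded_sum UNIV c e"
    unfolding theta_def c_def e_def using \<alpha>
    by (subst graded_sum_mult) (auto intro!: theta_graded_finite)
  also have "(UNIV :: (int \<times> int) set) = I 0 \<union> (I 1 \<union> I 2)"
    by (auto simp: I_def)
  also have "graded_sum (I 0 \<union> (I 1 \<union> I 2)) c e = graded_sum (I 0) c e + (graded_sum (I 1) c e + graded_sum (I 2) c e)"
    by (subst graded_sum_Un, rule graded_finite_subset[OF e], simp, force simp: I_def)
       (subst graded_sum_Un, rule graded_finite_subset[OF e], simp, auto simp: I_def)
  also have "graded_sum (I 0) c e = graded_sum UNIV (\<lambda>_. 1) (quint1_exp h a) * theta (2 * h) (4 * h)"
    unfolding theta_def graded_sum_mult[OF fin1 pent] UNIV_Times_UNIV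
    by (rule graded_sum_reindex[OF b0]) (simp_all only: c0 e0)
  also have "graded_sum (I 2) c e = - (graded_sum UNIV (\<lambda>_. 1) (quint2_exp h a) * theta (2 * h) (4 * h))"
    unfolding theta_def graded_sum_mult[OF fin2 pent] UNIV_Times_UNIV graded_sum_uminus[symmetric]
    by (rule graded_sum_reindex[OF b2]) (simp_all only: c2 e2)
  also have "graded_sum (I 1) c e = graded_sum UNIV (\<lambda>x. c (\<phi>1 x)) (\<lambda>x. e (\<phi>1 x))"
    by (rule graded_sum_reindex[OF b1]) simp_all
  also have "\<dots> = 0"
  proof (rule graded_sum_eq_0[where \<sigma> = "\<lambda>x. (fst x, 1 - snd x)"])
    show "bij_betw (\<lambda>x :: int \<times> int. (fst x, 1 - snd x)) UNIV UNIV"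
      by (rule bij_betw_byWitness[where f' = "\<lambda>x. (fst x, 1 - snd x)"]) auto
  qed (use c1 e1 in \<open>metis prod.collapse\<close>)+
  finally show "theta (h - a) a * theta (h - 2 * a) (h + 2 * a)
       = theta (2 * h) (4 * h) * (graded_sum UNIV (\<lambda>_. 1) (quint1_exp h a) - graded_sum UNIV (\<lambda>_. 1) (quint2_exp h a))"
    by (simp add: algebra_simps)
qed

text \<open>The signs in \<open>- 2 * k\<close> and \<open>- 2 * k - 1\<close> are chosen so that
  the split exponents coincide with quintuple exponents as functions, without further
  reindexing.\<close>

lemma graded_sum_parity_split:
  fixes e :: "int \<Rightarrow> int"
  assumes "graded_finite UNIV e"
  shows "graded_sum UNIV c e = graded_sum UNIV (\<lambda>k. c (- 2 * k)) (\<lambda>k. e (- 2 * k))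
       + graded_sum UNIV (\<lambda>k. c (- 2 * k - 1)) (\<lambda>k. e (- 2 * k - 1))"
proof -
  have "(UNIV :: int set) = {k. even k} \<union> {k. odd k}" by auto
  then have "graded_sum UNIV c e = graded_sum {k. even k} c e + graded_sum {k. odd k} c e"
    using assms by (metis (no_types, lifting) graded_sum_Un Collect_conj_eq Collect_empty_eq)
  also have "graded_sum {k. even k} c e = graded_sum UNIV (\<lambda>k. c (- 2 * k)) (\<lambda>k. e (- 2 * k))"
    by (rule graded_sum_reindex, rule bij_betw_byWitness[where f' = "\<lambda>k. - (k div 2)"]) auto
  also have "graded_sum {k. odd k} c e = graded_sum UNIV (\<lambda>k. c (- 2 * k - 1)) (\<lambda>k. e (- 2 * k - 1))"
    by (rule graded_sum_reindex, rule bij_betw_byWitness[where f' = "\<lambda>k. - ((k + 1) div 2)"]) (auto elim!: oddE)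
  finally show ?thesis .
qed

text \<open>For distinct \<open>a\<close> and \<open>b\<close> the three residue classes are
  disjoint and their products merge.\<close>

lemma theta_euler_prod:
  assumes "a \<ge> 1" "b \<ge> 1" "a \<noteq> b"
  shows "theta a b = euler_prod {k. k mod (2*(a+b)) \<in> {0, 2*a, 2*b}}"
proof -
  let ?M = "2 * (a + b)"
  let ?S = "\<lambda>c. {k. k mod ?M = c}"
  have "theta a b = euler_prod (?S 0) * euler_prod (?S (2*a)) * euler_prod (?S (2*b))"
    using assms by (simp add: jacobi_triple_product dvd_eq_mod_eq_0)
  also have "\<dots> = euler_prod (?S 0 \<union> ?S (2*a) \<union> ?S (2*b))"
    using assms by (subst euler_prod_Un, force, subst euler_prod_Un, auto)
  also have "?S 0 \<union> ?S (2*a) \<union> ?S (2*b) = {k. k mod ?M \<in> {0, 2*a, 2*b}}" by auto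
  finally show ?thesis .
qed

section \<open>Generating functions of weighted partitions\<close>

text \<open>Multiplicative weights serve both purposes: indicators count partitions with restricted
  parts, weights -1 give signed counts.\<close>

definition partition_gf :: "(nat \<Rightarrow> real) \<Rightarrow> real fps" where
  "partition_gf w = Abs_fps (\<lambda>n. \<Sum>p\<in>partitions_of n. \<Prod>k\<in>#p. w k)"

lemma prod_mset_of_bool: "(\<Prod>k\<in>#p. of_bool (P k)) = (of_bool (\<forall>k\<in>#p. P k) :: 'a::comm_semiring_1)"
  by (induction p) auto

lemma part_le: "p \<in> partitions_of n \<Longrightarrow> k \<in># p \<Longrightarrow> k \<le> n"
  by (auto simp: partitions_of_def dest!: multi_member_split)

text \<open>A partition either avoids \<open>N\<close>, which weight 0 at \<open>N\<close> enforces,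
  or arises from a partition of \<open>n - N\<close> by adding one part \<open>N\<close>.\<close>

lemma partition_gf_remove_part:
  assumes "N \<ge> 1"
  shows "partition_gf w = partition_gf (w(N := 0)) + fps_const (w N) * fps_X ^ N * partition_gf w"
proof (rule fps_ext)
  fix n
  let ?W = "\<lambda>p. \<Prod>k\<in>#p. w k"
  have "(\<Sum>p\<in>partitions_of n. ?W p)
      = (\<Sum>p | p \<in> partitions_of n \<and> N \<notin># p. ?W p) + (\<Sum>p | p \<in> partitions_of n \<and> N \<in># p. ?W p)"
    by (subst sum.union_disjoint[symmetric]) (auto simp: finite_partitions_of intro!: sum.cong)
  also have "(\<Sum>p | p \<in> partitions_of n \<and> N \<notin># p. ?W p)
      = (\<Sum>p\<in>partitions_of n. \<Prod>k\<in>#p. (w(N := 0)) k)"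
  proof (rule sum.mono_neutral_cong_left)
    fix p assume "p \<in> {p \<in> partitions_of n. N \<notin># p}"
    then show "?W p = (\<Prod>k\<in>#p. (w(N := 0)) k)"
      by (auto intro!: arg_cong[where f = prod_mset] image_mset_cong)
  qed (auto simp: finite_partitions_of dest!: multi_member_split)
  also have "(\<Sum>p | p \<in> partitions_of n \<and> N \<in># p. ?W p)
      = (if N \<le> n then w N * (\<Sum>p\<in>partitions_of (n - N). ?W p) else 0)"
  proof (cases "N \<le> n")
    case True
    have "(\<Sum>p | p \<in> partitions_of n \<and> N \<in># p. ?W p) = (\<Sum>p\<in>partitions_of (n - N). w N * ?W p)"
      by (rule sum.reindex_bij_witness[where i = "add_mset N" and j = "\<lambda>p. p - {#N#}"])
         (use assms True in \<open>auto simp: partitions_of_def dest!: multi_member_split\<close>)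
    with True show ?thesis by (simp add: sum_distrib_left)
  next
    case False
    then have "{p \<in> partitions_of n. N \<in># p} = {}" using part_le by blast
    with False show ?thesis by (simp only: sum.empty if_False)
  qed
  finally show "partition_gf w $ n
      = (partition_gf (w(N := 0)) + fps_const (w N) * fps_X ^ N * partition_gf w) $ n"
    by (simp add: partition_gf_def mult.assoc fps_X_power_mult_nth)
qed

text \<open>Each allowed part size contributes one factor; when none is left, only the empty
  partition survives.\<close>

lemma partition_gf_bounded:
  "partition_gf (\<lambda>k. if k \<le> N then w k else 0) * (\<Prod>k=1..N. 1 - fps_const (w k) * fps_X ^ k) = 1"
proof (induction N)
  case 0
  \<comment> \<open>The weight at 0 may be nonzero, but 0 is never a part.\<close>
  have "(\<Prod>k\<in>#p. if k \<le> 0 then w k else 0) = (if p = {#} then 1 else 0)" if "0 \<notin># p" for p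
    using that by (cases p) auto
  then have "(\<Sum>p\<in>partitions_of n. \<Prod>k\<in>#p. if k \<le> 0 then w k else 0) = (if n = 0 then 1 else 0)" for n
    by (subst sum.cong[OF refl, where h = "\<lambda>p. if p = {#} then 1 else 0"])
       (auto simp: partitions_of_def finite_partitions_of[unfolded partitions_of_def] sum.delta)
  then show ?case by (simp add: partition_gf_def fps_eq_iff)
next
  case (Suc N)
  let ?w = "\<lambda>N k. if k \<le> N then w k else 0"
  have "(?w (Suc N))(Suc N := 0) = ?w N" by auto
  with partition_gf_remove_part[of "Suc N" "?w (Suc N)"]
  have "partition_gf (?w (Suc N)) * (1 - fps_const (w (Suc N)) * fps_X ^ Suc N) = partition_gf (?w N)"
    by (simp add: algebra_simps)
  moreover have "(\<Prod>k=1..Suc N. 1 - fps_const (w k) * fps_X ^ k)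
      = (1 - fps_const (w (Suc N)) * fps_X ^ Suc N) * (\<Prod>k=1..N. 1 - fps_const (w k) * fps_X ^ k)"
    by (simp add: mult.commute)
  ultimately show ?case
    using Suc.IH by (simp only: mult.assoc[symmetric])
qed

text \<open>Up to degree \<open>n\<close> only parts up to \<open>n\<close> occur, so the bounded
  identity applies.\<close>

lemma partition_gf_mult_infprod:
  "partition_gf w * fps_infprod (\<lambda>k. 1 - fps_const (w k) * fps_X ^ k) = 1"
proof (rule fps_eqI_cong)
  fix n
  let ?w = "\<lambda>k. if k \<le> n then w k else 0"
  have "fps_cong (Suc n) (partition_gf w) (partition_gf ?w)"
    by (auto simp: fps_cong_def partition_gf_def dest: part_le
             intro!: sum.cong arg_cong[where f = prod_mset] image_mset_cong)
  moreover have "fps_cong (Suc n) (fps_infprod (\<lambda>k. 1 - fps_const (w k) * fps_X ^ k))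
      (\<Prod>k=1..n. 1 - fps_const (w k) * fps_X ^ k)"
    by (rule fps_infprod_cong) (simp add: fps_prod_conv_def)
  ultimately have "fps_cong (Suc n) (partition_gf w * fps_infprod (\<lambda>k. 1 - fps_const (w k) * fps_X ^ k))
      (partition_gf ?w * (\<Prod>k=1..n. 1 - fps_const (w k) * fps_X ^ k))"
    by (rule fps_cong_mult)
  then show "fps_cong n (partition_gf w * fps_infprod (\<lambda>k. 1 - fps_const (w k) * fps_X ^ k)) 1"
    unfolding partition_gf_bounded by (rule fps_cong_mono) simp
qed

text \<open>The common multiplier \<open>euler_prod UNIV\<close> clears denominators: the allowed
  parts cancel and the forbidden ones remain.\<close>

lemma partition_gf_indicator_mult_euler_prod:
  "partition_gf (\<lambda>k. of_bool (k \<in> S)) * euler_prod UNIV = euler_prod (- S)"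
proof -
  have "fps_infprod (\<lambda>k. 1 - fps_const (of_bool (k \<in> S)) * fps_X ^ k) = euler_prod S"
    unfolding euler_prod_def by (rule fps_infprod_eq_cong) simp
  then have "partition_gf (\<lambda>k. of_bool (k \<in> S)) * euler_prod S = 1"
    using partition_gf_mult_infprod[of "\<lambda>k. of_bool (k \<in> S)"] by simp
  moreover have "euler_prod UNIV = euler_prod S * euler_prod (- S)"
    by (simp flip: euler_prod_Un)
  ultimately show ?thesis by (simp flip: mult.assoc)
qed

lemma partition_gf_indicator_nth:
  "partition_gf (\<lambda>k. of_bool (k \<in> S)) $ n = card {p \<in> partitions_of n. \<forall>k\<in>#p. k \<in> S}"
  by (simp add: partition_gf_def prod_mset_of_bool finite_partitions_of Int_def)

lemma cong_int_iff_mod_nat: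
  assumes "m > 0"
  shows "[int k = r] (mod int m) \<longleftrightarrow> k mod m = nat (r mod int m)"
  using pos_mod_sign[of "int m" r] assms by (auto simp: cong_def zmod_int[symmetric])

lemma c48_gf: "partition_gf (\<lambda>k. of_bool (k \<in> - {k. k mod 48 \<in> {0, 2, 46, 20, 28, 22, 26, 24}})) $ n = c48 n"
proof -
  have "(\<forall>r\<in>{0, 2, -2, 20, -20, 22, -22, 24}. \<not> [int k = r] (mod 48))
      \<longleftrightarrow> k \<in> - {k. k mod 48 \<in> {0, 2, 46, 20, 28, 22, 26, 24}}" for k
    using cong_int_iff_mod_nat[of 48 k] by simp
  then show ?thesis
    by (simp only: partition_gf_indicator_nth c48_def parts_avoid_mod_def)
qed

text \<open>The factor \<open>X^2\<close> realises the shifted argument, including the value 0 for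
  \<open>n < 2\<close>.\<close>

lemma d48_gf:
  "(fps_X ^ 2 * partition_gf (\<lambda>k. of_bool (k \<in> - {k. k mod 48 \<in> {0, 4, 44, 10, 38, 14, 34, 24}}))) $ n
    = d48 (int n - 2)"
proof -
  have "(\<forall>r\<in>{0, 4, -4, 10, -10, 14, -14, 24}. \<not> [int k = r] (mod 48))
      \<longleftrightarrow> k \<in> - {k. k mod 48 \<in> {0, 4, 44, 10, 38, 14, 34, 24}}" for k
    using cong_int_iff_mod_nat[of 48 k] by simp
  moreover have "nat (int n - 2) = n - 2" by simp
  ultimately show ?thesis
    by (simp only: partition_gf_indicator_nth d48_def parts_avoid_mod_def fps_X_power_mult_nth) auto
qed

section \<open>The sign generating function and the three quintuple products\<close>

lemma euler_prod_double:
  "fps_infprod (\<lambda>k. if k \<in> S then 1 - fps_X ^ (2 * k) else 1) = euler_prod ((*) 2 ` S)"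
proof -
  let ?g = "\<lambda>l. if l \<in> (*) 2 ` S then 1 - fps_X ^ l else 1 :: real fps"
  have "fps_infprod (\<lambda>k. if k \<in> S then 1 - fps_X ^ (2 * k) else 1) = fps_infprod (\<lambda>k. ?g (2 * k))"
    by (rule fps_infprod_eq_cong) (auto simp: image_iff)
  also have "\<dots> = fps_infprod (\<lambda>k. if k \<in> (*) 2 ` {1..} then ?g k else 1)"
    by (rule fps_infprod_reindex[where \<phi> = "(*) 2" and g = ?g])
       (simp_all add: strict_mono_def fps_prod_conv_def)
  also have "\<dots> = euler_prod ((*) 2 ` S)"
    unfolding euler_prod_def by (rule fps_infprod_eq_cong) (auto simp: image_iff)
  finally show ?thesis .
qed

text \<open>The zeros enforce 6-regularity. Only even parts carry a sign, so only they produce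
  factors \<open>1 + X^k\<close>.\<close>

definition sign6 :: "nat \<Rightarrow> real" where
  "sign6 k = (if 6 dvd k then 0 else if even k then - 1 else 1)"

text \<open>For the even k not divisible by 6, write 1 + X^k as (1 - X^(2k)) / (1 - X^k). The
  doubled indices are the multiples of 4 that are not multiples of 12, hence again among these k.
  After cancellation the product \<open>Q\<close> is the reciprocal of the factors with k = 2 or 10
  modulo 12.\<close>

lemma partition_gf_sign6:
  "partition_gf sign6 * euler_prod UNIV = euler_prod {k. even k} * euler_prod {k. k mod 12 \<in> {2, 10}}"
proof -
  let ?E = "{k :: nat. even k \<and> \<not> 6 dvd k}" and ?T = "{k :: nat. k mod 12 \<in> {2, 10}}"
  define Q where "Q = fps_infprod (\<lambda>k. if k \<in> ?E then 1 + fps_X ^ k else 1 :: real fps)"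
  have convQ: "fps_prod_conv (\<lambda>k. if k \<in> ?E then 1 + fps_X ^ k else 1 :: real fps)"
    by (auto simp: fps_prod_conv_def fps_cong_def fps_X_power_nth)
  have minus_one: "fps_const (- 1) = (- 1 :: real fps)"
    by (simp add: fps_eq_iff)
  have "fps_infprod (\<lambda>k. 1 - fps_const (sign6 k) * fps_X ^ k) = euler_prod {k. odd k} * Q"
    unfolding Q_def euler_prod_def fps_infprod_mult[OF euler_prod_conv convQ, symmetric]
    by (rule fps_infprod_eq_cong) (auto simp: sign6_def minus_one)
  then have gf: "partition_gf sign6 * (euler_prod {k. odd k} * Q) = 1"
    using partition_gf_mult_infprod[of sign6] by simp
  have "Q * euler_prod ?E = fps_infprod (\<lambda>k. if k \<in> ?E then 1 - fps_X ^ (2 * k) else 1)"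
    unfolding Q_def euler_prod_def fps_infprod_mult[OF convQ euler_prod_conv, symmetric]
    by (rule fps_infprod_eq_cong) (simp add: algebra_simps mult_2_right power_add)
  also have "\<dots> = euler_prod ((*) 2 ` ?E)"
    by (rule euler_prod_double)
  finally have QE: "Q * euler_prod ?E = euler_prod ((*) 2 ` ?E)" .
  have double: "k \<in> (*) 2 ` ?E \<longleftrightarrow> 4 dvd k \<and> \<not> 12 dvd k" for k
  proof
    assume "k \<in> (*) 2 ` ?E"
    then obtain j where "k = 2 * j" "even j" "\<not> 6 dvd j" by auto
    then show "4 dvd k \<and> \<not> 12 dvd k" by presburger
  next
    assume k: "4 dvd k \<and> \<not> 12 dvd k"
    then have "k = 2 * (k div 2)" by presburger
    moreover have "k div 2 \<in> ?E"
      using k by (simp, presburger)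
    ultimately show "k \<in> (*) 2 ` ?E" by blast
  qed
  have union: "?E = ?T \<union> (*) 2 ` ?E"
  proof (rule set_eqI)
    fix k :: nat
    have "even k \<and> \<not> 6 dvd k \<longleftrightarrow> k mod 12 = 2 \<or> k mod 12 = 10 \<or> 4 dvd k \<and> \<not> 12 dvd k"
      by presburger
    then show "k \<in> ?E \<longleftrightarrow> k \<in> ?T \<union> (*) 2 ` ?E" by (simp add: double)
  qed
  have disj: "?T \<inter> (*) 2 ` ?E = {}"
  proof -
    have "\<not> k mod 12 \<in> {2, 10}" if "4 dvd k \<and> \<not> 12 dvd k" for k :: nat
      using that by (simp, presburger)
    then show ?thesis unfolding disjoint_iff double mem_Collect_eq by blast
  qed
  have "euler_prod ?E = euler_prod ?T * euler_prod ((*) 2 ` ?E)"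
    unfolding euler_prod_Un[OF disj, symmetric] by (rule arg_cong[OF union])
  with QE have "Q * euler_prod ?T * euler_prod ((*) 2 ` ?E) = 1 * euler_prod ((*) 2 ` ?E)"
    by (simp only: mult.assoc mult_1_left)
  then have QT: "Q * euler_prod ?T = 1"
    by (simp only: mult_cancel_right euler_prod_nonzero simp_thms)
  have UNIV: "euler_prod UNIV = euler_prod {k. odd k} * euler_prod {k. even k}"
    by (subst euler_prod_Un[symmetric], blast, rule arg_cong[where f = euler_prod], blast)
  have "partition_gf sign6 * euler_prod UNIV
      = partition_gf sign6 * (euler_prod {k. odd k} * euler_prod {k. even k}) * (Q * euler_prod ?T)"
    by (simp only: UNIV QT mult_1_right)
  also have "\<dots> = (partition_gf sign6 * (euler_prod {k. odd k} * Q)) * (euler_prod {k. even k} * euler_prod ?T)"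
    by (simp only: mult_ac)
  finally show ?thesis by (simp only: gf mult_1)
qed

text \<open>Euler's pentagonal number theorem in the variable X^(2a): modulo 6a, the residues 0, 2a
  and 4a are exactly the multiples of 2a.\<close>

lemma theta_pentagonal:
  assumes "a \<ge> 1"
  shows "theta a (2 * a) = euler_prod {k. 2 * a dvd k}"
proof -
  let ?m = "2 * a"
  have "k mod (2 * (a + 2 * a)) \<in> {0, 2 * a, 2 * (2 * a)} \<longleftrightarrow> ?m dvd k" for k
  proof
    assume "?m dvd k"
    then obtain j where "k = ?m * j" ..
    then have "k mod (?m * 3) = ?m * (j mod 3)" by (simp only: mult_mod_right)
    moreover have "j mod 3 = 0 \<or> j mod 3 = 1 \<or> j mod 3 = 2" by linarith
    moreover have "2 * (a + 2 * a) = ?m * 3" by simp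
    ultimately show "k mod (2 * (a + 2 * a)) \<in> {0, 2 * a, 2 * (2 * a)}" by auto
  next
    assume "k mod (2 * (a + 2 * a)) \<in> {0, 2 * a, 2 * (2 * a)}"
    then have "?m dvd k mod (2 * (a + 2 * a))" by auto
    moreover have "?m dvd 2 * (a + 2 * a)" by (simp flip: mult.assoc)
    ultimately show "?m dvd k" using dvd_mod_iff by blast
  qed
  with assms show ?thesis by (subst theta_euler_prod) simp_all
qed

lemma mod_24_of_mod_48: "k mod 24 = (k mod 48) mod 24" for k :: nat
  by (simp add: mod_mod_cancel)

section \<open>The three instances of the quintuple product and their splittings\<close>

abbreviation quint1 :: "nat \<Rightarrow> nat \<Rightarrow> real fps" where
  "quint1 h a \<equiv> graded_sum UNIV (\<lambda>_. 1) (quint1_exp h a)"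

abbreviation quint2 :: "nat \<Rightarrow> nat \<Rightarrow> real fps" where
  "quint2 h a \<equiv> graded_sum UNIV (\<lambda>_. 1) (quint2_exp h a)"

text \<open>The theta products have moduli 24 and 48. A finite check over residues modulo 48 shows
  that they cover the forbidden parts of \<open>c48\<close> once, apart from the multiples of 48;
  these occur twice, and the pentagonal factor removes one copy.\<close>

lemma quint_12_1: "euler_prod {k. k mod 48 \<in> {0, 2, 46, 20, 28, 22, 26, 24}} = quint1 12 1 - quint2 12 1"
    (is "euler_prod ?S = _")
proof -
  have "euler_prod {k. k mod 24 \<in> {0, 22, 2}} * euler_prod {k. k mod 48 \<in> {0, 20, 28}}
      = euler_prod {k. 48 dvd k} * (quint1 12 1 - quint2 12 1)"
    using quintuple_product[of 1 12] theta_pentagonal[of 24] by (simp add: theta_euler_prod)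
  moreover have "euler_prod {k. k mod 24 \<in> {0, 22, 2}} * euler_prod {k. k mod 48 \<in> {0, 20, 28}}
      = euler_prod {k. 48 dvd k} * euler_prod ?S"
  proof (rule euler_prod_mult)
    fix k :: nat
    have "\<forall>r\<in>{..<48::nat}. of_bool (r mod 24 \<in> {0, 22, 2}) + of_bool (r \<in> {0, 20, 28})
        = of_bool (r = 0) + (of_bool (r \<in> {0, 2, 46, 20, 28, 22, 26, 24}) :: nat)"
      by code_simp
    moreover have "k mod 48 \<in> {..<48}" by simp
    ultimately show "of_bool (k \<in> {k. k mod 24 \<in> {0, 22, 2}}) + of_bool (k \<in> {k. k mod 48 \<in> {0, 20, 28}})
       = of_bool (k \<in> {k. 48 dvd k}) + (of_bool (k \<in> ?S) :: nat)"
      unfolding mem_Collect_eq mod_24_of_mod_48[of k] dvd_eq_mod_eq_0 by blast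
  qed
  ultimately show ?thesis by simp
qed

text \<open>The same comparison for \<open>d48\<close>: residues 0, 10, 14 modulo 24 together with
  0, 4, 44 modulo 48.\<close>

lemma quint_12_5: "euler_prod {k. k mod 48 \<in> {0, 4, 44, 10, 38, 14, 34, 24}} = quint1 12 5 - quint2 12 5"
    (is "euler_prod ?S = _")
proof -
  have "euler_prod {k. k mod 24 \<in> {0, 14, 10}} * euler_prod {k. k mod 48 \<in> {0, 4, 44}}
      = euler_prod {k. 48 dvd k} * (quint1 12 5 - quint2 12 5)"
    using quintuple_product[of 5 12] theta_pentagonal[of 24] by (simp add: theta_euler_prod)
  moreover have "euler_prod {k. k mod 24 \<in> {0, 14, 10}} * euler_prod {k. k mod 48 \<in> {0, 4, 44}}
      = euler_prod {k. 48 dvd k} * euler_prod ?S"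
  proof (rule euler_prod_mult)
    fix k :: nat
    have "\<forall>r\<in>{..<48::nat}. of_bool (r mod 24 \<in> {0, 14, 10}) + of_bool (r \<in> {0, 4, 44})
        = of_bool (r = 0) + (of_bool (r \<in> {0, 4, 44, 10, 38, 14, 34, 24}) :: nat)"
      by code_simp
    moreover have "k mod 48 \<in> {..<48}" by simp
    ultimately show "of_bool (k \<in> {k. k mod 24 \<in> {0, 14, 10}}) + of_bool (k \<in> {k. k mod 48 \<in> {0, 4, 44}})
       = of_bool (k \<in> {k. 48 dvd k}) + (of_bool (k \<in> ?S) :: nat)"
      unfolding mem_Collect_eq mod_24_of_mod_48[of k] dvd_eq_mod_eq_0 by blast
  qed
  ultimately show ?thesis by simp
qed

text \<open>The theta product of modulus 6 covers all even numbers; the one of modulus 12 has an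
  extra class of multiples of 12, which the pentagonal factor cancels.\<close>

lemma quint_3_1:
  "euler_prod {k. even k} * euler_prod {k. k mod 12 \<in> {2, 10}} = quint1 3 1 - quint2 3 1"
proof -
  let ?Z = "{k :: nat. 12 dvd k}"
  have even: "{k. k mod 6 \<in> {0, 4, 2}} = {k :: nat. even k}" by (auto; presburger)
  have split: "{k. k mod 12 \<in> {0, 2, 10}} = ?Z \<union> {k :: nat. k mod 12 \<in> {2, 10}}"
    "?Z \<inter> {k :: nat. k mod 12 \<in> {2, 10}} = {}"
    by (auto simp: dvd_eq_mod_eq_0)
  have "euler_prod {k. k mod 6 \<in> {0, 4, 2}} * euler_prod {k. k mod 12 \<in> {0, 2, 10}}
      = euler_prod ?Z * (quint1 3 1 - quint2 3 1)"
    using quintuple_product[of 1 3] theta_pentagonal[of 6] by (simp add: theta_euler_prod)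
  then have "euler_prod ?Z * (euler_prod {k. even k} * euler_prod {k. k mod 12 \<in> {2, 10}})
      = euler_prod ?Z * (quint1 3 1 - quint2 3 1)"
    unfolding even split(1) euler_prod_Un[OF split(2)] by (simp only: mult_ac)
  then show ?thesis by simp
qed

text \<open>After k is replaced by -k, both exponents are 36k^2 + 18k + 2. This is the series that
  \<open>c48\<close> and the shifted \<open>d48\<close> share, with opposite signs.\<close>

lemma quint1_12_5_shift: "fps_X ^ 2 * quint1 12 5 = quint2 12 1"
proof -
  have "fps_X ^ 2 * quint1 12 5 = graded_sum UNIV (\<lambda>_. 1) (\<lambda>k. quint1_exp 12 5 k + int 2)"
    using quint1_graded_finite[of 5 12] by (intro graded_sum_shift) (auto simp: graded_finite_def)
  also have "\<dots> = quint2 12 1"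
    by (rule graded_sum_reindex[where \<phi> = uminus, symmetric], rule bij_betw_byWitness[where f' = uminus])
       (auto simp: quint1_exp_def quint2_exp_def)
  finally show ?thesis .
qed

lemma quint2_12_5_shift:
  "fps_X ^ 2 * quint2 12 5 = graded_sum UNIV (\<lambda>_. 1) (\<lambda>k. quint2_exp 12 5 k + 2)"
  using quint2_graded_finite[of 5 12] graded_sum_shift[of UNIV "quint2_exp 12 5" 2]
  by (simp add: graded_finite_def)

text \<open>The alternating signs make the terms of odd index negative.\<close>

lemma theta_3_6: "theta 3 6 = quint1 12 1 - fps_X ^ 2 * quint2 12 5"
proof -
  have "(\<lambda>k. theta_exp 3 6 (- 2 * k)) = quint1_exp 12 1"
    "(\<lambda>k. theta_exp 3 6 (- 2 * k - 1)) = (\<lambda>k. quint2_exp 12 5 k + 2)"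
    by (auto simp: theta_exp_def quint1_exp_def quint2_exp_def power2_eq_square algebra_simps)
  then show ?thesis
    unfolding theta_def quint2_12_5_shift
    by (subst graded_sum_parity_split[OF theta_graded_finite])
       (simp_all add: alt_sign_def graded_sum_uminus)
qed

text \<open>Its exponent 9k^2 - 3k is that of \<open>theta 3 6\<close>; without the alternating sign
  the odd half is added.\<close>

lemma quint1_3_1: "quint1 3 1 = quint1 12 1 + fps_X ^ 2 * quint2 12 5"
proof -
  have "(\<lambda>k. quint1_exp 3 1 (- 2 * k)) = quint1_exp 12 1"
    "(\<lambda>k. quint1_exp 3 1 (- 2 * k - 1)) = (\<lambda>k. quint2_exp 12 5 k + 2)"
    by (auto simp: quint1_exp_def quint2_exp_def power2_eq_square algebra_simps)
  then show ?thesis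
    unfolding quint2_12_5_shift
    by (subst graded_sum_parity_split[OF quint1_graded_finite]) simp_all
qed

text \<open>By \<open>quint1_12_5_shift\<close> the two halves are the same series.\<close>

lemma quint2_3_1: "quint2 3 1 = fps_X ^ 2 * quint1 12 5 + quint2 12 1"
proof -
  have "fps_X ^ 2 * quint1 12 5 = graded_sum UNIV (\<lambda>_. 1) (\<lambda>k. quint1_exp 12 5 k + int 2)"
    using quint1_graded_finite[of 5 12] by (intro graded_sum_shift) (auto simp: graded_finite_def)
  moreover have "(\<lambda>k. quint2_exp 3 1 (- 2 * k)) = (\<lambda>k. quint1_exp 12 5 k + int 2)"
    "(\<lambda>k. quint2_exp 3 1 (- 2 * k - 1)) = quint2_exp 12 1"
    by (auto simp: quint1_exp_def quint2_exp_def power2_eq_square algebra_simps)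
  ultimately show ?thesis
    by (subst graded_sum_parity_split[OF quint2_graded_finite])
       (simp_all add: quint1_12_5_shift quint1_exp_def quint2_exp_def)
qed

section \<open>Regular partitions by the parity of the number of parts\<close>

lemma b6_sum:
  "partition_gf (\<lambda>k. of_bool (k \<in> - {k. 6 dvd k})) $ n = real (b6e n) + real (b6o n)"
proof -
  have "{p \<in> partitions_of n. \<forall>k\<in>#p. k \<in> - {k. 6 dvd k}}
      = {p \<in> partitions_of n. regular_partition 6 p \<and> even (size p)}
      \<union> {p \<in> partitions_of n. regular_partition 6 p \<and> odd (size p)}"
    by (auto simp: regular_partition_def)
  then show ?thesis
    unfolding partition_gf_indicator_nth b6e_def b6o_def
    by (subst of_nat_add[symmetric], subst card_Un_disjoint[symmetric]) (auto simp: finite_partitions_of)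
qed

text \<open>The sign of a partition is \<open>- 1\<close> to the number of its even parts, which has the same parity
  as the sum of the parts plus their number.\<close>

lemma prod_sign6:
  "(\<Prod>k\<in>#p. sign6 k) = of_bool (regular_partition 6 p) * ((- 1) ^ size p * (- 1) ^ sum_mset p)"
  by (induction p) (auto simp: regular_partition_def sign6_def power_add)

lemma b6_diff:
  "partition_gf sign6 $ n = (- 1) ^ n * (real (b6e n) - real (b6o n))"
proof -
  let ?P = "partitions_of n"
  have "partition_gf sign6 $ n = (\<Sum>p\<in>?P. (- 1) ^ n * (of_bool (regular_partition 6 p \<and> even (size p))
      - of_bool (regular_partition 6 p \<and> odd (size p))))"
    unfolding partition_gf_def fps_nth_Abs_fps prod_sign6
    by (rule sum.cong) (auto simp: partitions_of_def)
  also have "\<dots> = (- 1) ^ n * (real (b6e n) - real (b6o n))"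
    by (simp add: b6e_def b6o_def finite_partitions_of Int_def sum_subtractf flip: sum_distrib_left)
  finally show ?thesis .
qed

theorem corollary1p6:
  fixes n :: nat
  shows "b6e n = (if even n then c48 n else d48 (int n - 2)) \<and>
         b6o n = (if odd n then c48 n else d48 (int n - 2))"
proof -
  define C where "C = partition_gf (\<lambda>k. of_bool (k \<in> - {k. k mod 48 \<in> {0, 2, 46, 20, 28, 22, 26, 24}}))"
  define D where "D = partition_gf (\<lambda>k. of_bool (k \<in> - {k. k mod 48 \<in> {0, 4, 44, 10, 38, 14, 34, 24}}))"
  define R where "R = partition_gf (\<lambda>k. of_bool (k \<in> - {k. 6 dvd k}))"
  have CD: "C * euler_prod UNIV = quint1 12 1 - quint2 12 1" "D * euler_prod UNIV = quint1 12 5 - quint2 12 5"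
    and R: "R * euler_prod UNIV = theta 3 6"
    and S: "partition_gf sign6 * euler_prod UNIV = quint1 3 1 - quint2 3 1"
    unfolding C_def D_def R_def partition_gf_indicator_mult_euler_prod partition_gf_sign6 double_compl
      quint_12_1 quint_12_5 quint_3_1 theta_pentagonal[of 3, simplified]
    by (rule refl)+
  \<comment> \<open>The shared series \<open>quint2 12 1\<close> cancels, which leaves the parity
    splitting of \<open>theta 3 6\<close>.\<close>
  have "(C + fps_X ^ 2 * D) * euler_prod UNIV = R * euler_prod UNIV"
    unfolding distrib_right mult.assoc CD R theta_3_6 by (simp add: right_diff_distrib quint1_12_5_shift)
  then have "C + fps_X ^ 2 * D = R" by simp
  then have sum: "real (c48 n) + real (d48 (int n - 2)) = real (b6e n) + real (b6o n)"
    using b6_sum[of n] c48_gf[of n] d48_gf[of n] unfolding C_def D_def R_def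
    by (metis fps_add_nth)
  \<comment> \<open>Here the shared series is doubled, as in \<open>quint2_3_1\<close>.\<close>
  have "(C - fps_X ^ 2 * D) * euler_prod UNIV = partition_gf sign6 * euler_prod UNIV"
    unfolding left_diff_distrib mult.assoc CD S quint1_3_1 quint2_3_1
    by (simp add: right_diff_distrib quint1_12_5_shift)
  then have "C - fps_X ^ 2 * D = partition_gf sign6" by simp
  then have diff: "real (c48 n) - real (d48 (int n - 2)) = (- 1) ^ n * (real (b6e n) - real (b6o n))"
    using b6_diff[of n] c48_gf[of n] d48_gf[of n] unfolding C_def D_def
    by (metis fps_sub_nth)
  \<comment> \<open>Sum and difference determine both counts; for odd \<open>n\<close> the sign of
    the difference exchanges the roles of \<open>b6e\<close> and \<open>b6o\<close>.\<close>
  show ?thesis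
    using sum diff by (cases "even n") auto
qed

end
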